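(* Let $p$ be an odd prime, $A$ a local pro-$p$ domain with maximal ideal $\mathfrak m$, residue field $\mathbb F$ and field of fractions $K$, and $\Pi$ a $p$-finite profinite group. Let $\rho:\Pi\to \mathrm{GL}_2(A)$ be a continuous representation such that $\bar\rho=\rho \bmod \mathfrak m$ is semisimple and multiplicity free. Let $A_0$ be the adjoint trace ring of $\rho$. If $\rho$ is $B$-full for some subring $B$ of $K$, then $A_0$ contains a subring that is a fullness peer of $B$.
   Context: All rings are unital. A local pro-$p$ ring is a commutative local topological ring that is an inverse limit of finite rings of $p$-power order, with finite residue field. A profinite group $\Pi$ is $p$-finite if for every open subgroup $\Pi_0\subseteq\Pi$ the set of continuous homomorphisms $\Pi_0\to\mathbb F_p$ is finite. $\bar\rho$ is multiplicity free if it is either absolutely irreducible or a sum of two distinct characters $\Pi\to\mathbb F^\times$. The adjoint trace ring $A_0$ of $\rho$ is the closed subring of $A$ topologically generated by the elements $(\operatorname{tr}\rho(g))^2/\det\rho(g)$ for $g\in\Pi$. For a ring $B$ and a nonzero ideal $\mathfrak b$ of $B$, let $\Gamma_B(\mathfrak b)=\ker(\mathrm{SL}_2(B)\to\mathrm{SL}_2(B/\mathfrak b))$. For a subring $B$ of $K$, $\rho$ is $B$-full if there are a nonzero ideal $\mathfrak b$ of $B$ and $x\in\mathrm{GL}_2(K)$ with $x^{-1}\rho(\Pi)x\supseteq\Gamma_B(\mathfrak b)$. Two subrings $B_1,B_2$ of $K$ are fullness peers if every nonzero ideal of $B_1$ contains a nonzero ideal of $B_2$ and vice versa. *)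

theory Defs
  imports "HOL-Algebra.Algebra" "HOL-Number_Theory.Residues"
    "HOL-Analysis.Function_Topology" "HOL-Analysis.Product_Topology" "HOL-Analysis.T1_Spaces"
begin

text \<open>The tuple \<open>(a, b, c, d)\<close> is the matrix with rows \<open>(a, b)\<close> and \<open>(c, d)\<close>.\<close>

type_synonym 'a mat2 = "'a \<times> 'a \<times> 'a \<times> 'a"

fun mat2_mult :: "('a, 'r) ring_scheme \<Rightarrow> 'a mat2 \<Rightarrow> 'a mat2 \<Rightarrow> 'a mat2" where
  "mat2_mult R (a, b, c, d) (a', b', c', d') =
    (a \<otimes>\<^bsub>R\<^esub> a' \<oplus>\<^bsub>R\<^esub> b \<otimes>\<^bsub>R\<^esub> c', a \<otimes>\<^bsub>R\<^esub> b' \<oplus>\<^bsub>R\<^esub> b \<otimes>\<^bsub>R\<^esub> d',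
     c \<otimes>\<^bsub>R\<^esub> a' \<oplus>\<^bsub>R\<^esub> d \<otimes>\<^bsub>R\<^esub> c', c \<otimes>\<^bsub>R\<^esub> b' \<oplus>\<^bsub>R\<^esub> d \<otimes>\<^bsub>R\<^esub> d')"

fun mat2_det :: "('a, 'r) ring_scheme \<Rightarrow> 'a mat2 \<Rightarrow> 'a" where
  "mat2_det R (a, b, c, d) = a \<otimes>\<^bsub>R\<^esub> d \<ominus>\<^bsub>R\<^esub> b \<otimes>\<^bsub>R\<^esub> c"

fun mat2_tr :: "('a, 'r) ring_scheme \<Rightarrow> 'a mat2 \<Rightarrow> 'a" where
  "mat2_tr R (a, b, c, d) = a \<oplus>\<^bsub>R\<^esub> d"

fun mat2_map :: "('a \<Rightarrow> 'b) \<Rightarrow> 'a mat2 \<Rightarrow> 'b mat2" where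
  "mat2_map f (a, b, c, d) = (f a, f b, f c, f d)"

fun mat2_vec :: "('a, 'r) ring_scheme \<Rightarrow> 'a mat2 \<Rightarrow> 'a \<times> 'a \<Rightarrow> 'a \<times> 'a" where
  "mat2_vec R (a, b, c, d) (x, y) =
    (a \<otimes>\<^bsub>R\<^esub> x \<oplus>\<^bsub>R\<^esub> b \<otimes>\<^bsub>R\<^esub> y, c \<otimes>\<^bsub>R\<^esub> x \<oplus>\<^bsub>R\<^esub> d \<otimes>\<^bsub>R\<^esub> y)"

definition M2 :: "('a, 'r) ring_scheme \<Rightarrow> 'a mat2 monoid" where
  "M2 R = \<lparr>carrier = carrier R \<times> carrier R \<times> carrier R \<times> carrier R,
           monoid.mult = mat2_mult R,
           one = (\<one>\<^bsub>R\<^esub>, \<zero>\<^bsub>R\<^esub>, \<zero>\<^bsub>R\<^esub>, \<one>\<^bsub>R\<^esub>)\<rparr>"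

definition GL2 :: "('a, 'r) ring_scheme \<Rightarrow> 'a mat2 monoid" where
  "GL2 R = units_of (M2 R)"

definition SL2 :: "('a, 'r) ring_scheme \<Rightarrow> 'a mat2 monoid" where
  "SL2 R = (M2 R)\<lparr>carrier := {x \<in> carrier (M2 R). mat2_det R x = \<one>\<^bsub>R\<^esub>}\<rparr>"

definition mat2_topology :: "'a topology \<Rightarrow> 'a mat2 topology" where
  "mat2_topology T = prod_topology T (prod_topology T (prod_topology T T))"

text \<open>The module of column vectors; its multiplicative part is irrelevant.\<close>

definition vec2 :: "('a, 'r) ring_scheme \<Rightarrow> ('a, 'a \<times> 'a) module" where
  "vec2 R = \<lparr>carrier = carrier R \<times> carrier R, monoid.mult = undefined, one = undefined,
             Ring.ring.zero = (\<zero>\<^bsub>R\<^esub>, \<zero>\<^bsub>R\<^esub>),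
             Ring.ring.add = (\<lambda>(x, y) (x', y'). (x \<oplus>\<^bsub>R\<^esub> x', y \<oplus>\<^bsub>R\<^esub> y')),
             smult = (\<lambda>a (x, y). (a \<otimes>\<^bsub>R\<^esub> x, a \<otimes>\<^bsub>R\<^esub> y))\<rparr>"

definition invariant_subspace ::
    "('g, 'h) monoid_scheme \<Rightarrow> ('a, 'r) ring_scheme \<Rightarrow> ('g \<Rightarrow> 'a mat2) \<Rightarrow> ('a \<times> 'a) set \<Rightarrow> bool"
  where "invariant_subspace G F \<sigma> W \<longleftrightarrow>
    submodule W F (vec2 F) \<and> (\<forall>g\<in>carrier G. \<forall>v\<in>W. mat2_vec F (\<sigma> g) v \<in> W)"

definition irreducible_rep ::
    "('g, 'h) monoid_scheme \<Rightarrow> ('a, 'r) ring_scheme \<Rightarrow> ('g \<Rightarrow> 'a mat2) \<Rightarrow> bool"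
  where "irreducible_rep G F \<sigma> \<longleftrightarrow>
    (\<forall>W. invariant_subspace G F \<sigma> W \<longrightarrow> W = {\<zero>\<^bsub>vec2 F\<^esub>} \<or> W = carrier (vec2 F))"

definition absolutely_irreducible_rep ::
    "('g, 'h) monoid_scheme \<Rightarrow> ('a, 'r) ring_scheme \<Rightarrow> ('g \<Rightarrow> 'a mat2) \<Rightarrow> bool"
  where "absolutely_irreducible_rep G F \<sigma> \<longleftrightarrow>
    irreducible_rep G (field.alg_closure F) (\<lambda>g. mat2_map (ring.indexed_const F) (\<sigma> g))"

definition semisimple_rep ::
    "('g, 'h) monoid_scheme \<Rightarrow> ('a, 'r) ring_scheme \<Rightarrow> ('g \<Rightarrow> 'a mat2) \<Rightarrow> bool"
  where "semisimple_rep G F \<sigma> \<longleftrightarrow>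
    (\<forall>W. invariant_subspace G F \<sigma> W \<longrightarrow>
      (\<exists>W'. invariant_subspace G F \<sigma> W' \<and> W \<inter> W' = {\<zero>\<^bsub>vec2 F\<^esub>} \<and>
            W <+>\<^bsub>vec2 F\<^esub> W' = carrier (vec2 F)))"

definition sum_of_distinct_characters ::
    "('g, 'h) monoid_scheme \<Rightarrow> ('a, 'r) ring_scheme \<Rightarrow> ('g \<Rightarrow> 'a mat2) \<Rightarrow> bool"
  where "sum_of_distinct_characters G F \<sigma> \<longleftrightarrow>
    (\<exists>\<chi>\<^sub>1 \<in> hom G (units_of F). \<exists>\<chi>\<^sub>2 \<in> hom G (units_of F). \<exists>P \<in> carrier (GL2 F).
      (\<exists>g\<in>carrier G. \<chi>\<^sub>1 g \<noteq> \<chi>\<^sub>2 g) \<and>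
      (\<forall>g\<in>carrier G. inv\<^bsub>GL2 F\<^esub> P \<otimes>\<^bsub>GL2 F\<^esub> \<sigma> g \<otimes>\<^bsub>GL2 F\<^esub> P = (\<chi>\<^sub>1 g, \<zero>\<^bsub>F\<^esub>, \<zero>\<^bsub>F\<^esub>, \<chi>\<^sub>2 g)))"

definition multiplicity_free_rep ::
    "('g, 'h) monoid_scheme \<Rightarrow> ('a, 'r) ring_scheme \<Rightarrow> ('g \<Rightarrow> 'a mat2) \<Rightarrow> bool"
  where "multiplicity_free_rep G F \<sigma> \<longleftrightarrow>
    absolutely_irreducible_rep G F \<sigma> \<or> sum_of_distinct_characters G F \<sigma>"

definition topological_group :: "('g, 'h) monoid_scheme \<Rightarrow> 'g topology \<Rightarrow> bool" where
  "topological_group G T \<longleftrightarrow> group G \<and> topspace T = carrier G \<and>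
     continuous_map (prod_topology T T) T (\<lambda>(x, y). x \<otimes>\<^bsub>G\<^esub> y) \<and>
     continuous_map T T (\<lambda>x. inv\<^bsub>G\<^esub> x)"

definition profinite_group :: "('g, 'h) monoid_scheme \<Rightarrow> 'g topology \<Rightarrow> bool" where
  "profinite_group G T \<longleftrightarrow> topological_group G T \<and> compact_space T \<and> Hausdorff_space T \<and>
     (\<forall>C. connectedin T C \<longrightarrow> (\<exists>x. C \<subseteq> {x}))"

text \<open>Homomorphisms on \<open>H\<close> are made \<open>extensional\<close> so that each of them is counted once.\<close>

definition p_finite :: "nat \<Rightarrow> ('g, 'h) monoid_scheme \<Rightarrow> 'g topology \<Rightarrow> bool" where
  "p_finite p G T \<longleftrightarrow> (\<forall>H. subgroup H G \<and> openin T H \<longrightarrow>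
     finite {f \<in> hom (G\<lparr>carrier := H\<rparr>) (add_monoid (residue_ring (int p))). f \<in> extensional H \<and>
       continuous_map (subtopology T H) (discrete_topology (carrier (residue_ring (int p)))) f})"

definition topological_ring :: "('a, 'r) ring_scheme \<Rightarrow> 'a topology \<Rightarrow> bool" where
  "topological_ring R T \<longleftrightarrow> ring R \<and> topspace T = carrier R \<and>
     continuous_map (prod_topology T T) T (\<lambda>(x, y). x \<oplus>\<^bsub>R\<^esub> y) \<and>
     continuous_map T T (\<lambda>x. \<ominus>\<^bsub>R\<^esub> x) \<and>
     continuous_map (prod_topology T T) T (\<lambda>(x, y). x \<otimes>\<^bsub>R\<^esub> y)"

definition inverse_system ::
    "'i set \<Rightarrow> ('i \<Rightarrow> 'i \<Rightarrow> bool) \<Rightarrow> ('i \<Rightarrow> ('s, 'r) ring_scheme) \<Rightarrow> ('i \<Rightarrow> 'i \<Rightarrow> 's \<Rightarrow> 's) \<Rightarrow> bool"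
  where "inverse_system I below S \<phi> \<longleftrightarrow>
    I \<noteq> {} \<and> (\<forall>i\<in>I. below i i) \<and>
    (\<forall>i\<in>I. \<forall>j\<in>I. \<forall>k\<in>I. below i j \<longrightarrow> below j k \<longrightarrow> below i k) \<and>
    (\<forall>i\<in>I. \<forall>j\<in>I. \<exists>k\<in>I. below i k \<and> below j k) \<and>
    (\<forall>i\<in>I. ring (S i)) \<and>
    (\<forall>i\<in>I. \<forall>j\<in>I. below i j \<longrightarrow> \<phi> i j \<in> ring_hom (S j) (S i)) \<and>
    (\<forall>i\<in>I. \<forall>s\<in>carrier (S i). \<phi> i i s = s) \<and>
    (\<forall>i\<in>I. \<forall>j\<in>I. \<forall>k\<in>I. below i j \<longrightarrow> below j k \<longrightarrow>
      (\<forall>s\<in>carrier (S k). \<phi> i j (\<phi> j k s) = \<phi> i k s))"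

definition inverse_limit ::
    "'i set \<Rightarrow> ('i \<Rightarrow> 'i \<Rightarrow> bool) \<Rightarrow> ('i \<Rightarrow> ('s, 'r) ring_scheme) \<Rightarrow> ('i \<Rightarrow> 'i \<Rightarrow> 's \<Rightarrow> 's) \<Rightarrow>
     ('i \<Rightarrow> 's) ring"
  where "inverse_limit I below S \<phi> =
    \<lparr>carrier = {s \<in> (\<Pi>\<^sub>E i\<in>I. carrier (S i)). \<forall>i\<in>I. \<forall>j\<in>I. below i j \<longrightarrow> \<phi> i j (s j) = s i},
     monoid.mult = (\<lambda>s t. \<lambda>i\<in>I. s i \<otimes>\<^bsub>S i\<^esub> t i),
     one = (\<lambda>i\<in>I. \<one>\<^bsub>S i\<^esub>),
     Ring.ring.zero = (\<lambda>i\<in>I. \<zero>\<^bsub>S i\<^esub>),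
     Ring.ring.add = (\<lambda>s t. \<lambda>i\<in>I. s i \<oplus>\<^bsub>S i\<^esub> t i)\<rparr>"

definition inverse_limit_topology ::
    "'i set \<Rightarrow> ('i \<Rightarrow> 'i \<Rightarrow> bool) \<Rightarrow> ('i \<Rightarrow> ('s, 'r) ring_scheme) \<Rightarrow> ('i \<Rightarrow> 'i \<Rightarrow> 's \<Rightarrow> 's) \<Rightarrow>
     ('i \<Rightarrow> 's) topology"
  where "inverse_limit_topology I below S \<phi> =
    subtopology (product_topology (\<lambda>i. discrete_topology (carrier (S i))) I)
      (carrier (inverse_limit I below S \<phi>))"

text \<open>
  Isomorphic, as a topological ring, to an inverse limit of (discrete) finite rings of \<open>p\<close>-power
  order. An existential quantifier cannot range over types, so indices and elements of the
  component rings are taken from the type \<open>'a set\<close>. This is no restriction: a ring \<open>R\<close> that is an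
  inverse limit of such rings \<open>S i\<close>, over whatever types, is also the inverse limit of its quotients
  by the kernels \<open>U i\<close> of the projections to the \<open>S i\<close>; these quotients embed into the \<open>S i\<close>, their
  elements are cosets in \<open>R\<close>, and the system is indexed by the set of all the \<open>U i\<close>.
\<close>

definition pro_p_ring :: "nat \<Rightarrow> ('a, 'r) ring_scheme \<Rightarrow> 'a topology \<Rightarrow> bool" where
  "pro_p_ring p R T \<longleftrightarrow>
    (\<exists>(I :: 'a set set) below (S :: 'a set \<Rightarrow> 'a set ring) \<phi> h.
      inverse_system I below S \<phi> \<and> (\<forall>i\<in>I. \<exists>n. order (S i) = p ^ n) \<and>
      h \<in> ring_iso R (inverse_limit I below S \<phi>) \<and>
      homeomorphic_map T (inverse_limit_topology I below S \<phi>) h)"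

definition local_ring :: "('a, 'r) ring_scheme \<Rightarrow> bool" where
  "local_ring R \<longleftrightarrow> cring R \<and> (\<exists>!m. maximalideal m R)"

definition local_pro_p_ring :: "nat \<Rightarrow> ('a, 'r) ring_scheme \<Rightarrow> 'a topology \<Rightarrow> bool" where
  "local_pro_p_ring p R T \<longleftrightarrow> topological_ring R T \<and> local_ring R \<and> pro_p_ring p R T \<and>
     (\<forall>m. maximalideal m R \<longrightarrow> finite (carrier (R Quot m)))"

definition field_of_fractions :: "('a, 'r) ring_scheme \<Rightarrow> 'a set \<Rightarrow> bool" where
  "field_of_fractions K A \<longleftrightarrow> field K \<and> subdomain A K \<and>
     (\<forall>x\<in>carrier K. \<exists>a\<in>A. \<exists>b\<in>A - {\<zero>\<^bsub>K\<^esub>}. x = a \<otimes>\<^bsub>K\<^esub> inv\<^bsub>K\<^esub> b)"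

definition continuous_rep ::
    "('g, 'h) monoid_scheme \<Rightarrow> 'g topology \<Rightarrow> ('a, 'r) ring_scheme \<Rightarrow> 'a topology \<Rightarrow>
     ('g \<Rightarrow> 'a mat2) \<Rightarrow> bool"
  where "continuous_rep G T\<^sub>G R T\<^sub>R \<rho> \<longleftrightarrow>
    \<rho> \<in> hom G (GL2 R) \<and>
    continuous_map T\<^sub>G (subtopology (mat2_topology T\<^sub>R) (carrier (GL2 R))) \<rho>"

definition reduce_rep ::
    "('a, 'r) ring_scheme \<Rightarrow> 'a set \<Rightarrow> ('g \<Rightarrow> 'a mat2) \<Rightarrow> 'g \<Rightarrow> 'a set mat2"
  where "reduce_rep R m \<rho> = (\<lambda>g. mat2_map (\<lambda>a. m +>\<^bsub>R\<^esub> a) (\<rho> g))"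

definition adjoint_trace_ring ::
    "('g, 'h) monoid_scheme \<Rightarrow> ('a, 'r) ring_scheme \<Rightarrow> 'a topology \<Rightarrow> ('g \<Rightarrow> 'a mat2) \<Rightarrow> 'a set"
  where "adjoint_trace_ring G R T \<rho> =
    \<Inter>{S. subring S R \<and> closedin T S \<and>
        (\<forall>g\<in>carrier G. mat2_tr R (\<rho> g) [^]\<^bsub>R\<^esub> (2::nat) \<otimes>\<^bsub>R\<^esub> inv\<^bsub>R\<^esub> (mat2_det R (\<rho> g)) \<in> S)}"

definition congruence_subgroup :: "('a, 'r) ring_scheme \<Rightarrow> 'a set \<Rightarrow> 'a mat2 set" where
  "congruence_subgroup B \<bb> = kernel (SL2 B) (SL2 (B Quot \<bb>)) (mat2_map (\<lambda>x. \<bb> +>\<^bsub>B\<^esub> x))"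

definition nonzero_ideal :: "'a set \<Rightarrow> ('a, 'r) ring_scheme \<Rightarrow> bool" where
  "nonzero_ideal \<bb> B \<longleftrightarrow> ideal \<bb> B \<and> \<bb> \<noteq> {\<zero>\<^bsub>B\<^esub>}"

definition full_rep ::
    "('g, 'h) monoid_scheme \<Rightarrow> ('a, 'r) ring_scheme \<Rightarrow> ('g \<Rightarrow> 'a mat2) \<Rightarrow> 'a set \<Rightarrow> bool"
  where "full_rep G K \<rho> B \<longleftrightarrow>
    (\<exists>\<bb>. nonzero_ideal \<bb> (K\<lparr>carrier := B\<rparr>) \<and>
      (\<exists>x\<in>carrier (GL2 K). congruence_subgroup (K\<lparr>carrier := B\<rparr>) \<bb> \<subseteq>
        (\<lambda>g. inv\<^bsub>GL2 K\<^esub> x \<otimes>\<^bsub>GL2 K\<^esub> \<rho> g \<otimes>\<^bsub>GL2 K\<^esub> x) ` carrier G))"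

definition fullness_peers :: "('a, 'r) ring_scheme \<Rightarrow> 'a set \<Rightarrow> 'a set \<Rightarrow> bool" where
  "fullness_peers K B\<^sub>1 B\<^sub>2 \<longleftrightarrow> subring B\<^sub>1 K \<and> subring B\<^sub>2 K \<and>
    (\<forall>I. nonzero_ideal I (K\<lparr>carrier := B\<^sub>1\<rparr>) \<longrightarrow>
      (\<exists>J. nonzero_ideal J (K\<lparr>carrier := B\<^sub>2\<rparr>) \<and> J \<subseteq> I)) \<and>
    (\<forall>J. nonzero_ideal J (K\<lparr>carrier := B\<^sub>2\<rparr>) \<longrightarrow>
      (\<exists>I. nonzero_ideal I (K\<lparr>carrier := B\<^sub>1\<rparr>) \<and> I \<subseteq> J))"

end

theory Submission
  imports Defs
begin

text \<open>
  The proof evaluates the adjoint traces of a few elements whose image fullness prescribes. Choose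
  \<open>s \<noteq> 0\<close> in the ideal \<open>\<bb>\<close> for which a conjugate of the image contains the congruence subgroup. For
  every \<open>b \<in> B\<close> the product of the elementary matrices with off-diagonal entries \<open>s\<close> and \<open>b s\<close> lies
  in this subgroup, has determinant 1 and has trace \<open>2 + b s\<^sup>2\<close>
  (\<open>congruence_subgroup_witness\<close>). Trace and determinant do not change under conjugation
  (\<open>GL2_conj_tr_det\<close>), so the adjoint trace ring \<open>A\<^sub>0\<close> contains \<open>(2 + b s\<^sup>2)\<^sup>2\<close>, and likewise
  \<open>(2 - b s\<^sup>2)\<^sup>2\<close>. Their difference \<open>8 b s\<^sup>2\<close> is linear in \<open>b\<close>, so with \<open>v = 8 s\<^sup>2\<close> the whole of
  \<open>v B\<close> lies in \<open>A\<^sub>0\<close>. Here \<open>v \<noteq> 0\<close>, because 2 cannot vanish in a nonzero inverse limit of finite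
  rings of odd order (\<open>one_eq_zero_if_pro_odd\<close>).

  The fullness peer is \<open>C = A\<^sub>0 \<inter> B\<close>: it is a subring of \<open>B\<close> that contains the nonzero ideal
  \<open>v B\<close> of \<open>B\<close>, and multiplication by \<open>v\<close> moves nonzero ideals of either ring into nonzero ideals
  of the other (\<open>fullness_peers_if_conductor\<close>).
\<close>

section \<open>Traces and determinants of two-by-two matrices\<close>

lemma M2_simps [simp]:
  "carrier (M2 R) = carrier R \<times> carrier R \<times> carrier R \<times> carrier R"
  "x \<otimes>\<^bsub>M2 R\<^esub> y = mat2_mult R x y"
  "\<one>\<^bsub>M2 R\<^esub> = (\<one>\<^bsub>R\<^esub>, \<zero>\<^bsub>R\<^esub>, \<zero>\<^bsub>R\<^esub>, \<one>\<^bsub>R\<^esub>)"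
  by (simp_all add: M2_def)

context cring
begin

lemma M2_monoid: "monoid (M2 R)"
  by (rule monoidI) (auto simp: l_distr r_distr m_assoc a_ac)

lemma mat2_tr_mult_comm:
  assumes "x \<in> carrier (M2 R)" "y \<in> carrier (M2 R)"
  shows "mat2_tr R (mat2_mult R x y) = mat2_tr R (mat2_mult R y x)"
  using assms by (auto simp: a_ac m_comm)

lemma mat2_det_mult:
  assumes "x \<in> carrier (M2 R)" "y \<in> carrier (M2 R)"
  shows "mat2_det R (mat2_mult R x y) = mat2_det R x \<otimes> mat2_det R y"
proof -
  obtain a b c d a' b' c' d' where xy: "x = (a, b, c, d)" "y = (a', b', c', d')"
    by (metis prod.exhaust)
  then have "{a, b, c, d, a', b', c', d'} \<subseteq> carrier R"
    using assms by auto
  then show ?thesis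
    unfolding xy mat2_mult.simps mat2_det.simps by (simp, algebra)
qed

lemma mat2_det_closed: "x \<in> carrier (M2 R) \<Longrightarrow> mat2_det R x \<in> carrier R"
  by auto

lemma GL2_conj_tr_det:
  assumes x: "x \<in> carrier (GL2 R)" and r: "r \<in> carrier (M2 R)"
  defines "y \<equiv> inv\<^bsub>GL2 R\<^esub> x \<otimes>\<^bsub>GL2 R\<^esub> r \<otimes>\<^bsub>GL2 R\<^esub> x"
  shows "mat2_tr R y = mat2_tr R r" and "mat2_det R y = mat2_det R r"
proof -
  interpret M: monoid "M2 R" by (rule M2_monoid)
  have xU: "x \<in> Units (M2 R)"
    using x by (simp add: GL2_def units_of_def)
  define z where "z = inv\<^bsub>M2 R\<^esub> x"
  have z: "z \<in> carrier (M2 R)" and xc: "x \<in> carrier (M2 R)"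
    using xU unfolding z_def by (blast intro: M.Units_inv_closed M.Units_closed)+
  have zx: "mat2_mult R z x = \<one>\<^bsub>M2 R\<^esub>" and xz: "mat2_mult R x z = \<one>\<^bsub>M2 R\<^esub>"
    using M.Units_l_inv[OF xU] M.Units_r_inv[OF xU] unfolding z_def by (simp_all only: M2_simps)
  have y: "y = mat2_mult R (mat2_mult R z r) x"
    using xU by (simp add: y_def z_def GL2_def M.units_of_inv units_of_mult)
  have zr: "mat2_mult R z r \<in> carrier (M2 R)"
    using M.m_closed[OF z r] by (simp only: M2_simps)
  have "mat2_tr R y = mat2_tr R (mat2_mult R x (mat2_mult R z r))"
    unfolding y by (rule mat2_tr_mult_comm[OF zr xc])
  also have "mat2_mult R x (mat2_mult R z r) = mat2_mult R (mat2_mult R x z) r"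
    using M.m_assoc[OF xc z r] by (simp only: M2_simps)
  also have "\<dots> = r"
    using M.l_one[OF r] unfolding xz by (simp only: M2_simps)
  finally show "mat2_tr R y = mat2_tr R r" .
  have "mat2_det R z \<otimes> mat2_det R x = \<one>"
    unfolding mat2_det_mult[OF z xc, symmetric] zx by (simp add: minus_eq)
  then show "mat2_det R y = mat2_det R r"
    unfolding y mat2_det_mult[OF zr xc] mat2_det_mult[OF z r]
    using mat2_det_closed[OF z] mat2_det_closed[OF r] mat2_det_closed[OF xc]
    by (metis m_assoc m_comm l_one)
qed

text \<open>
  This is the product of the unipotent matrices \<open>(1, s, 0, 1)\<close> and \<open>(1, 0, b s, 1)\<close>. Both are
  trivial modulo \<open>I\<close>, while the trace \<open>2 + b s\<^sup>2\<close> of the product varies with \<open>b\<close>.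
\<close>

lemma congruence_subgroup_witness:
  assumes I: "ideal I R" and s: "s \<in> I" and b: "b \<in> carrier R"
  shows "(\<one> \<oplus> b \<otimes> (s \<otimes> s), s, b \<otimes> s, \<one>) \<in> congruence_subgroup R I"
proof -
  interpret I: ideal I R by (rule I)
  have sc: "s \<in> carrier R" using s by (rule I.Icarr)
  have bs: "b \<otimes> s \<in> I" and bss: "b \<otimes> (s \<otimes> s) \<in> I"
    using s b sc by (simp_all add: I.I_l_closed)
  have "mat2_det R (\<one> \<oplus> b \<otimes> (s \<otimes> s), s, b \<otimes> s, \<one>) = \<one>"
    using b sc by (simp, algebra)
  moreover have "I +> (\<one> \<oplus> b \<otimes> (s \<otimes> s)) = I +> \<one>"
  proof -
    have "\<one> \<oplus> b \<otimes> (s \<otimes> s) \<ominus> \<one> = b \<otimes> (s \<otimes> s)"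
      using b sc by algebra
    then show ?thesis
      using bss b sc quotient_eq_iff_same_a_r_cos[OF I, of "\<one> \<oplus> b \<otimes> (s \<otimes> s)" \<one>] by simp
  qed
  ultimately show ?thesis
    using b sc s bs a_rcos_zero[OF I]
    by (simp add: congruence_subgroup_def kernel_def SL2_def M2_def FactRing_def)
qed

end

section \<open>Fullness peers inside a subring\<close>

lemma (in domain) nonzero_principal_ideal:
  assumes S: "subring S R" and s: "s \<in> S" "s \<noteq> \<zero>"
  shows "nonzero_ideal {x \<otimes> s |x. x \<in> S} (R\<lparr>carrier := S\<rparr>)"
proof -
  interpret S: domain "R\<lparr>carrier := S\<rparr>" by (rule subring_is_domain[OF S])
  have "PIdl\<^bsub>R\<lparr>carrier := S\<rparr>\<^esub> s = {x \<otimes> s |x. x \<in> S}"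
    by (simp add: cgenideal_def)
  then show ?thesis
    using S.cgenideal_ideal[of s] S.cgenideal_self[of s] s by (auto simp: nonzero_ideal_def)
qed

lemma nonzero_ideal_obtain:
  assumes "nonzero_ideal I R"
  obtains i where "i \<in> I" "i \<noteq> \<zero>\<^bsub>R\<^esub>"
proof -
  interpret ideal I R using assms by (simp add: nonzero_ideal_def)
  show ?thesis using assms that zero_closed by (auto simp: nonzero_ideal_def)
qed

text \<open>
  The hypotheses say that the conductor of \<open>C\<close> in \<open>B\<close> contains \<open>v \<noteq> 0\<close>. For a nonzero element \<open>i\<close>
  of an ideal of \<open>C\<close>, the ideal \<open>v i B = (v B) i\<close> of \<open>B\<close> stays inside that ideal; for a nonzero
  element \<open>j\<close> of an ideal of \<open>B\<close>, the element \<open>j v\<close> lies in \<open>C\<close>, and the ideal of \<open>C\<close> that it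
  generates stays inside the ideal of \<open>B\<close>.
\<close>

lemma (in domain) fullness_peers_if_conductor:
  assumes C: "subring C R" and B: "subring B R" and CB: "C \<subseteq> B"
    and v: "v \<in> B" "v \<noteq> \<zero>" and vB: "\<And>b. b \<in> B \<Longrightarrow> b \<otimes> v \<in> C"
  shows "fullness_peers R C B"
  unfolding fullness_peers_def
proof (intro conjI allI impI C B)
  have BR: "B \<subseteq> carrier R" using B by (rule subringE(1))
  {
    fix I assume I: "nonzero_ideal I (R\<lparr>carrier := C\<rparr>)"
    then interpret I: ideal I "R\<lparr>carrier := C\<rparr>" by (simp add: nonzero_ideal_def)
    obtain i where i: "i \<in> I" "i \<noteq> \<zero>" using nonzero_ideal_obtain[OF I] by auto
    have iB: "i \<in> B" using I.Icarr[OF i(1)] CB by auto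
    have "v \<otimes> i \<in> B" using v iB by (simp add: subringE(6)[OF B])
    moreover have "v \<otimes> i \<noteq> \<zero>" using v iB i BR integral by blast
    ultimately have "nonzero_ideal {x \<otimes> (v \<otimes> i) |x. x \<in> B} (R\<lparr>carrier := B\<rparr>)"
      by (rule nonzero_principal_ideal[OF B])
    moreover have "{x \<otimes> (v \<otimes> i) |x. x \<in> B} \<subseteq> I"
    proof clarify
      fix x assume x: "x \<in> B"
      have "(x \<otimes> v) \<otimes> i \<in> I" using I.I_l_closed[OF i(1)] vB[OF x] by simp
      then show "x \<otimes> (v \<otimes> i) \<in> I" using x v iB BR by (metis m_assoc subsetD)
    qed
    ultimately show "\<exists>J. nonzero_ideal J (R\<lparr>carrier := B\<rparr>) \<and> J \<subseteq> I" by blast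
  next
    fix J assume J: "nonzero_ideal J (R\<lparr>carrier := B\<rparr>)"
    then interpret J: ideal J "R\<lparr>carrier := B\<rparr>" by (simp add: nonzero_ideal_def)
    obtain j where j: "j \<in> J" "j \<noteq> \<zero>" using nonzero_ideal_obtain[OF J] by auto
    have jB: "j \<in> B" using J.Icarr[OF j(1)] by simp
    have jv: "j \<otimes> v \<in> J" using J.I_r_closed[OF j(1)] v by simp
    have "j \<otimes> v \<in> C" by (rule vB[OF jB])
    moreover have "j \<otimes> v \<noteq> \<zero>" using v jB j BR integral by blast
    ultimately have "nonzero_ideal {x \<otimes> (j \<otimes> v) |x. x \<in> C} (R\<lparr>carrier := C\<rparr>)"
      by (rule nonzero_principal_ideal[OF C])
    moreover have "{x \<otimes> (j \<otimes> v) |x. x \<in> C} \<subseteq> J"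
      using J.I_l_closed[OF jv] CB by auto
    ultimately show "\<exists>I. nonzero_ideal I (R\<lparr>carrier := C\<rparr>) \<and> I \<subseteq> J" by blast
  }
qed

section \<open>Two is nonzero in a nontrivial pro-p ring for odd p\<close>

text \<open>The additive order of 1 divides both 2 and the odd order of the ring.\<close>

lemma (in ring) one_eq_zero_if_odd_order:
  assumes odd: "odd (order R)" and two: "\<one> \<oplus> \<one> = \<zero>"
  shows "\<one> = \<zero>"
proof -
  obtain k where k: "order R = 2 * k + 1" using odd by (rule oddE)
  have sq: "[(2::nat)] \<cdot>\<^bsub>R\<^esub> \<one> = \<zero>"
    using two by (simp add: numeral_2_eq_2)
  have "\<zero> = [(2 * k + 1)] \<cdot>\<^bsub>R\<^esub> \<one>"
    using add.pow_order_eq_1[of \<one>] k by (simp add: order_def)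
  also have "\<dots> = [k] \<cdot>\<^bsub>R\<^esub> ([(2::nat)] \<cdot>\<^bsub>R\<^esub> \<one>) \<oplus> \<one>"
    using add.nat_pow_pow[of \<one> k 2] by (simp add: mult.commute)
  also have "\<dots> = \<one>"
    by (simp add: sq)
  finally show ?thesis by simp
qed

text \<open>
  If \<open>1 + 1 = 0\<close>, the same holds in every finite ring of the system, so all of them are trivial, and
  then so is the limit.
\<close>

lemma (in ring) one_eq_zero_if_pro_odd:
  assumes p: "odd p" and pro: "pro_p_ring p R T" and two: "\<one> \<oplus> \<one> = \<zero>"
  shows "\<one> = \<zero>"
proof -
  obtain I :: "'a set set" and below and S :: "'a set \<Rightarrow> 'a set ring" and \<phi> h where
    sys: "inverse_system I below S \<phi>" and ord: "\<And>i. i \<in> I \<Longrightarrow> \<exists>n. order (S i) = p ^ n"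
    and h: "h \<in> ring_iso R (inverse_limit I below S \<phi>)"
    using pro unfolding pro_p_ring_def by blast
  let ?L = "inverse_limit I below S \<phi>"
  have hom: "h \<in> ring_hom R ?L" and inj: "inj_on h (carrier R)"
    using h by (auto simp: ring_iso_def bij_betw_def)
  \<comment> \<open>The limit is not known here to be a ring, so the homomorphism is read off in each component.\<close>
  have ext: "h x \<in> (\<Pi>\<^sub>E i\<in>I. carrier (S i))" if "x \<in> carrier R" for x
    using ring_hom_closed[OF hom that] by (simp add: inverse_limit_def)
  have add: "h (x \<oplus> y) i = h x i \<oplus>\<^bsub>S i\<^esub> h y i"
    if "x \<in> carrier R" "y \<in> carrier R" "i \<in> I" for x y i
    using ring_hom_add[OF hom that(1,2)] that(3) by (simp add: inverse_limit_def)
  have "h \<one> i = h \<zero> i" if i: "i \<in> I" for i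
  proof -
    interpret S: ring "S i" using sys i by (auto simp: inverse_system_def)
    have one: "h \<one> i = \<one>\<^bsub>S i\<^esub>"
      using ring_hom_one[OF hom] i by (simp add: inverse_limit_def)
    have "h \<zero> i \<in> carrier (S i)" using ext[of \<zero>] i by auto
    then have zero: "h \<zero> i = \<zero>\<^bsub>S i\<^esub>"
      using add[of \<zero> \<zero> i] i by (simp add: S.add.l_cancel_one')
    have "\<one>\<^bsub>S i\<^esub> \<oplus>\<^bsub>S i\<^esub> \<one>\<^bsub>S i\<^esub> = \<zero>\<^bsub>S i\<^esub>"
      using add[of \<one> \<one> i] i two one zero by simp
    moreover have "odd (order (S i))" using ord[OF i] p by auto
    ultimately show ?thesis using S.one_eq_zero_if_odd_order one zero by simp
  qed
  then have "h \<one> = h \<zero>" using ext[of \<one>] ext[of \<zero>] by (intro PiE_ext) auto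
  then show ?thesis using inj by (simp add: inj_on_eq_iff)
qed

section \<open>The adjoint trace ring contains a multiple of the full coefficient ring\<close>

text \<open>
  With \<open>2\<close> written as \<open>\<one> \<oplus> \<one>\<close>, this is \<open>(2 + u)\<^sup>2 - (2 - u)\<^sup>2 = 8 u\<close>. Subtracting removes the terms
  \<open>4 + u\<^sup>2\<close>, which are not linear in \<open>u\<close>.
\<close>

lemma (in cring) diff_of_squares_about_two:
  assumes "u \<in> carrier R"
  shows "(\<one> \<oplus> u \<oplus> \<one>) [^] (2::nat) \<ominus> (\<one> \<oplus> \<ominus> u \<oplus> \<one>) [^] (2::nat)
    = u \<otimes> ((\<one> \<oplus> \<one>) \<otimes> ((\<one> \<oplus> \<one>) \<otimes> (\<one> \<oplus> \<one>)))"
  using assms unfolding numeral_2_eq_2 nat_pow_Suc nat_pow_0 by algebra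

theorem theorem1:
  fixes p :: nat
    and K :: "('a, 'r) ring_scheme" and A \<mm> B :: "'a set" and T\<^sub>A :: "'a topology"
    and G :: "('g, 'h) monoid_scheme" and T\<^sub>G :: "'g topology"
    and \<rho> :: "'g \<Rightarrow> 'a mat2"
  assumes "Factorial_Ring.prime p" and "odd p"
    and "field_of_fractions K A"
    and "local_pro_p_ring p (K\<lparr>carrier := A\<rparr>) T\<^sub>A"
    and "maximalideal \<mm> (K\<lparr>carrier := A\<rparr>)"
    and "profinite_group G T\<^sub>G" and "p_finite p G T\<^sub>G"
    and "continuous_rep G T\<^sub>G (K\<lparr>carrier := A\<rparr>) T\<^sub>A \<rho>"
    and "semisimple_rep G (K\<lparr>carrier := A\<rparr> Quot \<mm>) (reduce_rep (K\<lparr>carrier := A\<rparr>) \<mm> \<rho>)"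
    and "multiplicity_free_rep G (K\<lparr>carrier := A\<rparr> Quot \<mm>) (reduce_rep (K\<lparr>carrier := A\<rparr>) \<mm> \<rho>)"
    and "subring B K" and "full_rep G K \<rho> B"
  shows "\<exists>C. C \<subseteq> adjoint_trace_ring G (K\<lparr>carrier := A\<rparr>) T\<^sub>A \<rho> \<and>
    subring C K \<and> fullness_peers K C B"
proof -
  let ?R = "K\<lparr>carrier := A\<rparr>" and ?B = "K\<lparr>carrier := B\<rparr>"
  interpret K: field K using assms(3) by (simp add: field_of_fractions_def)
  have A: "subdomain A K" using assms(3) by (simp add: field_of_fractions_def)
  interpret R: domain ?R using K.subdomain_is_domain[OF A] .
  have B: "subring B K" by fact
  interpret B: domain ?B using K.subring_is_domain[OF B] .
  have AK: "A \<subseteq> carrier K" using A by (rule subdomainE(1))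
  have BK: "B \<subseteq> carrier K" using B by (rule subringE(1))
  define S where "S = {S. subring S ?R \<and> closedin T\<^sub>A S \<and>
        (\<forall>g\<in>carrier G. mat2_tr ?R (\<rho> g) [^]\<^bsub>?R\<^esub> (2::nat) \<otimes>\<^bsub>?R\<^esub> inv\<^bsub>?R\<^esub> (mat2_det ?R (\<rho> g)) \<in> S)}"
  have A0: "adjoint_trace_ring G ?R T\<^sub>A \<rho> = \<Inter>S"
    by (simp add: adjoint_trace_ring_def S_def)
  have subS: "subring Y K" if Y: "Y \<in> S" for Y
  proof -
    have YR: "subring Y ?R" using Y by (simp add: S_def)
    then have "Y \<subseteq> A" using subringE(1) by fastforce
    then have "Y \<subseteq> carrier K" using AK by blast
    then show ?thesis
      by (rule K.ring_incl_imp_subring) (use R.subring_is_ring[OF YR] in simp)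
  qed
  obtain \<bb> x where \<bb>: "nonzero_ideal \<bb> ?B" and x: "x \<in> carrier (GL2 K)"
    and full: "congruence_subgroup ?B \<bb> \<subseteq>
      (\<lambda>g. inv\<^bsub>GL2 K\<^esub> x \<otimes>\<^bsub>GL2 K\<^esub> \<rho> g \<otimes>\<^bsub>GL2 K\<^esub> x) ` carrier G"
    using assms(12) unfolding full_rep_def by blast
  obtain s where s: "s \<in> \<bb>" "s \<noteq> \<zero>\<^bsub>K\<^esub>" using nonzero_ideal_obtain[OF \<bb>] by auto
  have \<bb>i: "ideal \<bb> ?B" using \<bb> by (simp add: nonzero_ideal_def)
  have sB: "s \<in> B" using ideal.Icarr[OF \<bb>i s(1)] by simp
  have sK: "s \<in> carrier K" using sB BK by blast
  have \<rho>: "\<rho> g \<in> A \<times> A \<times> A \<times> A" if "g \<in> carrier G" for g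
    using assms(8) that by (auto simp: continuous_rep_def GL2_def units_of_def Units_def dest!: hom_carrier)
  have tr: "mat2_tr ?R m = mat2_tr K m" for m by (cases m) simp
  have subA: "subring A K" using A by (simp add: subdomain_def subcring_def)
  have neg: "\<ominus>\<^bsub>?R\<^esub> y = \<ominus>\<^bsub>K\<^esub> y" if "y \<in> A" for y
    using that AK subringE(5)[OF subA that] by (intro R.minus_equality) (auto simp: K.l_neg)
  have det: "mat2_det ?R m = mat2_det K m" if "m \<in> A \<times> A \<times> A \<times> A" for m
    using that subringE(6)[OF subA] by (auto simp: a_minus_def neg)
  have trace: "(\<one>\<^bsub>K\<^esub> \<oplus>\<^bsub>K\<^esub> b \<otimes>\<^bsub>K\<^esub> (s \<otimes>\<^bsub>K\<^esub> s) \<oplus>\<^bsub>K\<^esub> \<one>\<^bsub>K\<^esub>) [^]\<^bsub>K\<^esub> (2::nat) \<in> Y"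
    if Y: "Y \<in> S" and b: "b \<in> B" for Y b
  proof -
    let ?\<gamma> = "(\<one>\<^bsub>K\<^esub> \<oplus>\<^bsub>K\<^esub> b \<otimes>\<^bsub>K\<^esub> (s \<otimes>\<^bsub>K\<^esub> s), s, b \<otimes>\<^bsub>K\<^esub> s, \<one>\<^bsub>K\<^esub>)"
    have bK: "b \<in> carrier K" using b BK by blast
    have "?\<gamma> \<in> congruence_subgroup ?B \<bb>"
      using B.congruence_subgroup_witness[OF \<bb>i s(1)] b by simp
    then obtain g where g: "g \<in> carrier G"
      and \<gamma>: "?\<gamma> = inv\<^bsub>GL2 K\<^esub> x \<otimes>\<^bsub>GL2 K\<^esub> \<rho> g \<otimes>\<^bsub>GL2 K\<^esub> x"
      using full by blast
    have \<rho>K: "\<rho> g \<in> carrier (M2 K)" using \<rho>[OF g] AK by auto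
    have "mat2_tr K (\<rho> g) = mat2_tr K ?\<gamma>" "mat2_det K (\<rho> g) = mat2_det K ?\<gamma>"
      unfolding \<gamma> by (simp_all only: K.GL2_conj_tr_det[OF x \<rho>K])
    moreover have "mat2_det K ?\<gamma> = \<one>\<^bsub>K\<^esub>"
      using bK sK by (simp, algebra)
    ultimately have tr\<rho>: "mat2_tr ?R (\<rho> g) = \<one>\<^bsub>K\<^esub> \<oplus>\<^bsub>K\<^esub> b \<otimes>\<^bsub>K\<^esub> (s \<otimes>\<^bsub>K\<^esub> s) \<oplus>\<^bsub>K\<^esub> \<one>\<^bsub>K\<^esub>"
      and det\<rho>: "mat2_det ?R (\<rho> g) = \<one>\<^bsub>?R\<^esub>"
      using det[OF \<rho>[OF g]] by (simp_all add: tr)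
    have "mat2_tr ?R (\<rho> g) [^]\<^bsub>?R\<^esub> (2::nat) \<otimes>\<^bsub>?R\<^esub> inv\<^bsub>?R\<^esub> (mat2_det ?R (\<rho> g)) \<in> Y"
      using Y g by (simp add: S_def)
    then show ?thesis
      unfolding det\<rho> R.inv_one tr\<rho> using bK sK by (simp add: numeral_2_eq_2 nat_pow_def)
  qed
  define e where "e = \<one>\<^bsub>K\<^esub> \<oplus>\<^bsub>K\<^esub> \<one>\<^bsub>K\<^esub>"
  \<comment> \<open>\<open>v\<close> is \<open>8 s\<^sup>2\<close>, bracketed as in the difference of squares.\<close>
  define v where "v = (s \<otimes>\<^bsub>K\<^esub> s) \<otimes>\<^bsub>K\<^esub> (e \<otimes>\<^bsub>K\<^esub> (e \<otimes>\<^bsub>K\<^esub> e))"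
  have eB: "e \<in> B" unfolding e_def by (simp add: subringE(3,7)[OF B])
  then have eK: "e \<in> carrier K" using BK by blast
  have "e \<noteq> \<zero>\<^bsub>K\<^esub>"
    using R.one_eq_zero_if_pro_odd[of p T\<^sub>A] assms(2,4) by (auto simp: local_pro_p_ring_def e_def)
  then have v0: "v \<noteq> \<zero>\<^bsub>K\<^esub>" using sK s(2) eK by (simp add: v_def K.integral_iff)
  have vB: "v \<in> B" unfolding v_def by (intro subringE(6)[OF B] sB eB)
  have absorb: "b \<otimes>\<^bsub>K\<^esub> v \<in> Y" if Y: "Y \<in> S" and b: "b \<in> B" for Y b
  proof -
    let ?u = "b \<otimes>\<^bsub>K\<^esub> (s \<otimes>\<^bsub>K\<^esub> s)"
    have bK: "b \<in> carrier K" using b BK by blast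
    have neg: "(\<ominus>\<^bsub>K\<^esub> b) \<otimes>\<^bsub>K\<^esub> (s \<otimes>\<^bsub>K\<^esub> s) = \<ominus>\<^bsub>K\<^esub> ?u"
      using bK sK by (simp add: K.l_minus)
    have "(\<one>\<^bsub>K\<^esub> \<oplus>\<^bsub>K\<^esub> ?u \<oplus>\<^bsub>K\<^esub> \<one>\<^bsub>K\<^esub>) [^]\<^bsub>K\<^esub> (2::nat)
        \<ominus>\<^bsub>K\<^esub> (\<one>\<^bsub>K\<^esub> \<oplus>\<^bsub>K\<^esub> (\<ominus>\<^bsub>K\<^esub> ?u) \<oplus>\<^bsub>K\<^esub> \<one>\<^bsub>K\<^esub>) [^]\<^bsub>K\<^esub> (2::nat) \<in> Y"
      using trace[OF Y b] trace[OF Y subringE(5)[OF B b]] subS[OF Y] unfolding neg K.minus_eq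
      by (intro subringE(5,7)) auto
    then have "?u \<otimes>\<^bsub>K\<^esub> (e \<otimes>\<^bsub>K\<^esub> (e \<otimes>\<^bsub>K\<^esub> e)) \<in> Y"
      using K.diff_of_squares_about_two[of ?u] bK sK by (simp add: e_def)
    then show ?thesis using bK sK eK by (simp add: v_def K.m_assoc)
  qed
  (* The ring B is a member of the intersected family so that C is visibly an intersection of
     subrings of K, also when S is empty. *)
  define C where "C = \<Inter>(insert B S)"
  have C: "subring C K"
    unfolding C_def by (rule K.subring_Inter) (use subS B in auto)
  moreover have "fullness_peers K C B"
  proof (rule K.fullness_peers_if_conductor[OF C B _ vB v0])
    show "C \<subseteq> B" by (auto simp: C_def)
    show "b \<otimes>\<^bsub>K\<^esub> v \<in> C" if "b \<in> B" for b
      using absorb[OF _ that] that vB subringE(6)[OF B] by (auto simp: C_def)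
  qed
  moreover have "C \<subseteq> adjoint_trace_ring G ?R T\<^sub>A \<rho>" unfolding A0 C_def by blast
  ultimately show ?thesis by blast
qed

end
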